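(* The Jacobi operator $J$ defined on sequences $f = (f_n)_{n \in \mathbb{N}}$ by $$(J f)_n := \sqrt{n(n+1)(n+2)}\, f_{n+1} + \sqrt{(n-1) n (n+1)}\, f_{n-1}, \quad n \in \mathbb{N},$$ has a limit circle at infinity.
   Context: $\mathbb{N} = \{1,2,3,\dots\}$. For $n=1$ the coefficient of $f_{0}$ is zero, so $f_0$ plays no role. The operator $J$ is said to have a limit circle at infinity if a solution $f$ of the Jacobi difference equation $Jf = zf$ with $f_1 = 1$ belongs to $\ell^2(\mathbb{N})$ for some $z \in \mathbb{C}$. *)

theory Defs
  imports "HOL-Analysis.Analysis"
begin

text \<open>
  Sequences indexed by the positive integers are functions \<open>f :: nat \<Rightarrow> complex\<close> of which only
  the values \<open>f n\<close> with \<open>n \<ge> 1\<close> matter; conditions on such sequences are imposed on \<open>{1..}\<close> only.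
\<close>

text \<open>The subtraction in the second coefficient is taken in the reals; in \<open>f (n - 1)\<close> it is the
  natural-number one, which is exact for \<open>n \<ge> 1\<close>. At \<open>n = 1\<close> the coefficient of \<open>f 0\<close> is zero.\<close>

definition jacobi_J :: "(nat \<Rightarrow> complex) \<Rightarrow> nat \<Rightarrow> complex" where
  "jacobi_J f n =
     complex_of_real (sqrt (real n * (real n + 1) * (real n + 2))) * f (n + 1)
   + complex_of_real (sqrt ((real n - 1) * real n * (real n + 1))) * f (n - 1)"

definition in_ell2 :: "(nat \<Rightarrow> complex) \<Rightarrow> bool" where
  "in_ell2 f \<longleftrightarrow> (\<lambda>n. (cmod (f n))\<^sup>2) summable_on {1..}"

definition limit_circle_at_infinity :: "((nat \<Rightarrow> complex) \<Rightarrow> nat \<Rightarrow> complex) \<Rightarrow> bool" where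
  "limit_circle_at_infinity J \<longleftrightarrow>
     (\<exists>z f. (\<forall>n\<ge>1. J f n = z * f n) \<and> f 1 = 1 \<and> in_ell2 f)"

end

theory Submission
  imports Defs
begin

text \<open>
  At \<open>z = 0\<close> the equation reads \<open>f\<^bsub>n+2\<^esub> = - sqrt (n / (n+3)) f\<^bsub>n\<^esub>\<close>, so the solution vanishes at
  even indices. With \<open>h\<^bsub>n\<^esub> = (n+1) f\<^bsub>n\<^esub>\<^sup>2\<close> the recurrence gives \<open>f\<^bsub>n\<^esub>\<^sup>2 = h\<^bsub>n\<^esub> - h\<^bsub>n+2\<^esub>\<close>, so the series
  of squares telescopes and its partial sums are at most \<open>h\<^bsub>0\<^esub> + h\<^bsub>1\<^esub> = 2\<close>.
\<close>

fun zero_energy_solution :: "nat \<Rightarrow> real" where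
  "zero_energy_solution 0 = 0"
| "zero_energy_solution (Suc 0) = 1"
| "zero_energy_solution (Suc (Suc n)) =
     - sqrt (real n / (real n + 3)) * zero_energy_solution n"

lemma jacobi_J_zero_energy_solution:
  assumes "n \<ge> 1"
  shows "jacobi_J (\<lambda>n. complex_of_real (zero_energy_solution n)) n = 0"
proof -
  obtain m where n: "n = Suc m"
    using assms by (cases n) auto
  \<comment> \<open>The equation at index \<open>Suc m\<close> links entries \<open>m + 2\<close>
    and \<open>m\<close>; the factor \<open>m + 3\<close> cancels under the root.\<close>
  have "sqrt ((real m + 1) * (real m + 2) * (real m + 3)) * sqrt (real m / (real m + 3))
      = sqrt (real m * (real m + 1) * (real m + 2))"
    unfolding real_sqrt_mult[symmetric] by (simp add: field_simps)
  then have "sqrt ((real m + 1) * (real m + 2) * (real m + 3)) * zero_energy_solution (Suc (Suc m))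
      + sqrt (real m * (real m + 1) * (real m + 2)) * zero_energy_solution m = 0"
    by (metis (no_types, lifting) add.left_inverse minus_mult_left minus_mult_right mult.assoc
        zero_energy_solution.simps(3))
  then have "complex_of_real (sqrt ((real m + 1) * (real m + 2) * (real m + 3))
      * zero_energy_solution (Suc (Suc m))
      + sqrt (real m * (real m + 1) * (real m + 2)) * zero_energy_solution m) = 0"
    by (simp only: of_real_0)
  then show ?thesis
    unfolding jacobi_J_def n by (simp add: add_ac del: zero_energy_solution.simps)
qed

text \<open>Telescoping in steps of two leaves two boundary terms, one for each parity.\<close>

lemma sum_zero_energy_solution_squared:
  "(\<Sum>k<n. (zero_energy_solution k)\<^sup>2) =
     2 - (real n + 1) * (zero_energy_solution n)\<^sup>2 - (real n + 2) * (zero_energy_solution (Suc n))\<^sup>2"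
proof (induction n)
  case (Suc n)
  \<comment> \<open>Writing \<open>n\<close> as \<open>(n + 1) - 1\<close> on the right turns this
    into the telescoping relation.\<close>
  have "(real n + 3) * (zero_energy_solution (Suc (Suc n)))\<^sup>2 = real n * (zero_energy_solution n)\<^sup>2"
    by (simp add: power_mult_distrib)
  with Suc.IH show ?case
    by (simp add: algebra_simps del: zero_energy_solution.simps)
qed simp

lemma in_ell2_zero_energy_solution:
  "in_ell2 (\<lambda>n. complex_of_real (zero_energy_solution n))"
proof -
  have "(\<Sum>k<n. (zero_energy_solution k)\<^sup>2) \<le> 2" for n
  proof -
    have "0 \<le> (real n + 1) * (zero_energy_solution n)\<^sup>2"
      and "0 \<le> (real n + 2) * (zero_energy_solution (Suc n))\<^sup>2"
      by simp_all
    then show ?thesis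
      unfolding sum_zero_energy_solution_squared by linarith
  qed
  then have "summable (\<lambda>n. (zero_energy_solution n)\<^sup>2)"
    by (intro bounded_imp_summable[where B = 2]) (simp_all flip: lessThan_Suc_atMost del: sum.lessThan_Suc)
  \<comment> \<open>Nonnegative terms make the convergent series unconditionally summable, as
    \<open>in_ell2\<close> demands.\<close>
  then have "(\<lambda>n. (zero_energy_solution n)\<^sup>2) summable_on UNIV"
    by (rule summable_nonneg_imp_summable_on) simp
  then show ?thesis
    unfolding in_ell2_def by (auto intro: summable_on_subset)
qed

theorem lemma4p1: "limit_circle_at_infinity jacobi_J"
  unfolding limit_circle_at_infinity_def
  by (intro exI[of _ 0] exI[of _ "\<lambda>n. complex_of_real (zero_energy_solution n)"])
    (simp add: jacobi_J_zero_energy_solution in_ell2_zero_energy_solution)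

end
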